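(* For every integer $n \geq 2$, $\mathrm{conn}(\mathcal{N}(K_{n+1}^{K_n})) = 0$, where $\mathcal{N}(K_{n+1}^{K_n})$ is the neighborhood complex of the exponential graph $K_{n+1}^{K_n}$.
   Context: A graph $G$ is a pair $(V(G),E(G))$ with $E(G)\subset V(G)\times V(G)$ symmetric (undirected graph; loops are allowed); $x\sim y$ means $(x,y)\in E(G)$. $K_n$ is the complete graph on $[n]=\{1,\dots,n\}$, without loops. Exponential graph: for graphs $G,H$, $H^G$ is the graph whose vertices are all set maps $V(G)\to V(H)$, with $f\sim f'$ iff for all $v,v'\in V(G)$, $v\sim v'$ in $G$ implies $f(v)\sim f'(v')$ in $H$. Neighborhood complex: $\mathcal{N}(G)$ is the abstract simplicial complex whose simplices are the (finite, nonempty) subsets of $V(G)$ that have a common neighbor in $G$; it is regarded as a topological space via geometric realization. Connectivity: a nonempty space $X$ is $k$-connected ($k\ge 0$) if $\pi_j(X)=0$ for all $0\le j\le k$, where $\pi_0(X)=0$ means that $X$ is (path) connected. $\mathrm{conn}(X)$ is the largest integer $k$ such that $X$ is $k$-connected; a nonempty disconnected space has $\mathrm{conn}(X)=-1$, and $\mathrm{conn}(\emptyset)=-\infty$. *)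

theory Defs
  imports "HOL-Analysis.Analysis"
begin

section \<open>Graphs\<close>

type_synonym 'a graph = "'a set \<times> ('a \<times> 'a) set"

abbreviation verts :: "'a graph \<Rightarrow> 'a set" where "verts G \<equiv> fst G"

abbreviation edges :: "'a graph \<Rightarrow> ('a \<times> 'a) set" where "edges G \<equiv> snd G"

definition is_graph :: "'a graph \<Rightarrow> bool" where
  "is_graph G \<longleftrightarrow> edges G \<subseteq> verts G \<times> verts G \<and> sym (edges G)"

definition complete_graph :: "nat \<Rightarrow> nat graph" where
  "complete_graph n = ({1..n}, {(i, j). i \<in> {1..n} \<and> j \<in> {1..n} \<and> i \<noteq> j})"

text \<open>The exponential graph \<open>H\<^sup>G\<close>. Maps \<open>V(G) \<rightarrow> V(H)\<close> are represented by the extensional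
  functions in \<^term>\<open>PiE\<close>, so that distinct HOL functions are distinct maps.\<close>

definition exp_graph :: "'b graph \<Rightarrow> 'a graph \<Rightarrow> ('a \<Rightarrow> 'b) graph" where
  "exp_graph H G =
    (verts G \<rightarrow>\<^sub>E verts H,
     {(f, f'). f \<in> verts G \<rightarrow>\<^sub>E verts H \<and> f' \<in> verts G \<rightarrow>\<^sub>E verts H \<and>
        (\<forall>v\<in>verts G. \<forall>v'\<in>verts G. (v, v') \<in> edges G \<longrightarrow> (f v, f' v') \<in> edges H)})"

lemma is_graph_complete_graph: "is_graph (complete_graph n)"
  by (auto simp: is_graph_def complete_graph_def sym_def)

lemma is_graph_exp_graph:
  assumes "is_graph H" "is_graph G"
  shows "is_graph (exp_graph H G)"
  using assms unfolding is_graph_def exp_graph_def sym_def by fastforce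


section \<open>Simplicial complexes and their realizations\<close>

text \<open>An abstract simplicial complex is given by its set of (finite, nonempty) simplices.\<close>

definition neighborhood_complex :: "'a graph \<Rightarrow> 'a set set" where
  "neighborhood_complex G =
    {S. finite S \<and> S \<noteq> {} \<and> S \<subseteq> verts G \<and> (\<exists>w\<in>verts G. \<forall>v\<in>S. (v, w) \<in> edges G)}"

text \<open>The closed simplex spanned by \<open>S\<close>, in barycentric coordinates.\<close>

definition closed_simplex :: "'a set \<Rightarrow> ('a \<Rightarrow> real) set" where
  "closed_simplex S = {x. (\<forall>v. 0 \<le> x v) \<and> (\<forall>v. v \<notin> S \<longrightarrow> x v = 0) \<and> (\<Sum>v\<in>S. x v) = 1}"

text \<open>The realization carries the weak topology: a set is open iff its trace on every closed
  simplex is open there. Each closed simplex has its Euclidean topology, which is the one induced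
  by the product topology on \<^typ>\<open>'a \<Rightarrow> real\<close> because simplices are finite.\<close>

definition geom_realization :: "'a set set \<Rightarrow> ('a \<Rightarrow> real) topology" where
  "geom_realization K =
    topology (\<lambda>U. U \<subseteq> (\<Union>S\<in>K. closed_simplex S) \<and>
      (\<forall>S\<in>K. openin (top_of_set (closed_simplex S)) (U \<inter> closed_simplex S)))"

lemma openin_geom_realization:
  "openin (geom_realization K) U \<longleftrightarrow>
     U \<subseteq> (\<Union>S\<in>K. closed_simplex S) \<and>
     (\<forall>S\<in>K. openin (top_of_set (closed_simplex S)) (U \<inter> closed_simplex S))"
proof -
  have "istopology (\<lambda>U. U \<subseteq> (\<Union>S\<in>K. closed_simplex S) \<and>
      (\<forall>S\<in>K. openin (top_of_set (closed_simplex S)) (U \<inter> closed_simplex S)))"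
    (is "istopology ?P")
    unfolding istopology_def
  proof (intro conjI allI impI)
    fix U V assume "?P U" "?P V"
    moreover have "U \<inter> V \<inter> T = (U \<inter> T) \<inter> (V \<inter> T)" for T by blast
    ultimately show "U \<inter> V \<subseteq> (\<Union>S\<in>K. closed_simplex S)"
      "\<forall>S\<in>K. openin (top_of_set (closed_simplex S)) (U \<inter> V \<inter> closed_simplex S)"
      by (auto simp del: Int_assoc intro: openin_Int)
  next
    fix \<U> assume *: "\<forall>U\<in>\<U>. ?P U"
    then show "\<Union>\<U> \<subseteq> (\<Union>S\<in>K. closed_simplex S)" by blast
    show "\<forall>S\<in>K. openin (top_of_set (closed_simplex S)) (\<Union>\<U> \<inter> closed_simplex S)"
      unfolding Int_Union2 using * by blast
  qed
  then show ?thesis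
    unfolding geom_realization_def by simp
qed

lemma topspace_geom_realization:
  "topspace (geom_realization K) = (\<Union>S\<in>K. closed_simplex S)"
proof (rule antisym)
  show "topspace (geom_realization K) \<subseteq> (\<Union>S\<in>K. closed_simplex S)"
    using openin_geom_realization openin_topspace by blast
  have "openin (geom_realization K) (\<Union>S\<in>K. closed_simplex S)"
    unfolding openin_geom_realization by (metis Sup_upper image_eqI inf.absorb_iff2 openin_subtopology_self order_refl)
  then show "(\<Union>S\<in>K. closed_simplex S) \<subseteq> topspace (geom_realization K)"
    by (rule openin_subset)
qed


section \<open>Homotopy groups and connectivity\<close>

definition cube :: "nat \<Rightarrow> (nat \<Rightarrow> real) topology" where
  "cube j = product_topology (\<lambda>_. top_of_set {0..1}) {..<j}"

definition cube_boundary :: "nat \<Rightarrow> (nat \<Rightarrow> real) set" where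
  "cube_boundary j = {t \<in> topspace (cube j). \<exists>i<j. t i = 0 \<or> t i = 1}"

definition spheroids :: "nat \<Rightarrow> 'a topology \<Rightarrow> 'a \<Rightarrow> ((nat \<Rightarrow> real) \<Rightarrow> 'a) set" where
  "spheroids j X x0 = {f. continuous_map (cube j) X f \<and> (\<forall>t\<in>cube_boundary j. f t = x0)}"

definition spheroid_homotopy ::
    "nat \<Rightarrow> 'a topology \<Rightarrow> 'a \<Rightarrow> (((nat \<Rightarrow> real) \<Rightarrow> 'a) \<times> ((nat \<Rightarrow> real) \<Rightarrow> 'a)) set" where
  "spheroid_homotopy j X x0 =
    {(f, g). homotopic_with (\<lambda>h. \<forall>t\<in>cube_boundary j. h t = x0) (cube j) X f g}"

text \<open>The underlying set of \<open>\<pi>\<^sub>j(X, x\<^sub>0)\<close>, as homotopy classes of maps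
  \<open>(I\<^sup>j, \<partial>I\<^sup>j) \<rightarrow> (X, x\<^sub>0)\<close>. The group structure is not needed to say that the group is trivial.\<close>

definition homotopy_group :: "nat \<Rightarrow> 'a topology \<Rightarrow> 'a \<Rightarrow> ((nat \<Rightarrow> real) \<Rightarrow> 'a) set set" where
  "homotopy_group j X x0 = spheroids j X x0 // spheroid_homotopy j X x0"

lemma equiv_spheroid_homotopy: "equiv (spheroids j X x0) (spheroid_homotopy j X x0)"
proof (rule equivI)
  show "spheroid_homotopy j X x0 \<subseteq> spheroids j X x0 \<times> spheroids j X x0"
    by (auto simp: spheroid_homotopy_def spheroids_def
        dest: homotopic_with_imp_continuous_maps homotopic_with_imp_property)
  show "refl_on (spheroids j X x0) (spheroid_homotopy j X x0)"
    by (auto simp: refl_on_def spheroid_homotopy_def spheroids_def)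
  show "sym (spheroid_homotopy j X x0)"
    by (auto simp: sym_def spheroid_homotopy_def homotopic_with_sym)
  show "trans (spheroid_homotopy j X x0)"
    by (auto simp: trans_def spheroid_homotopy_def intro: homotopic_with_trans)
qed

definition k_connected :: "nat \<Rightarrow> 'a topology \<Rightarrow> bool" where
  "k_connected k X \<longleftrightarrow>
    topspace X \<noteq> {} \<and> path_connected_space X \<and>
    (\<forall>j\<in>{1..k}. \<forall>x0\<in>topspace X. is_singleton (homotopy_group j X x0))"

text \<open>The set of \<open>k\<close> with \<^term>\<open>k_connected k X\<close> is downward closed, so the supremum is the largest
  such \<open>k\<close> if there is one, and \<open>\<infinity>\<close> if \<open>X\<close> is \<open>k\<close>-connected for all \<open>k\<close>.\<close>

definition conn :: "'a topology \<Rightarrow> ereal" where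
  "conn X = (if topspace X = {} then - \<infinity>
             else Sup (insert (- 1) {ereal (real k) | k. k_connected k X}))"

lemma k_connected_mono: "k_connected k X \<Longrightarrow> l \<le> k \<Longrightarrow> k_connected l X"
  by (auto simp: k_connected_def)

lemma conn_eq_iff: "conn X = ereal (real k) \<longleftrightarrow> k_connected k X \<and> \<not> k_connected (Suc k) X"
proof
  let ?A = "insert (- 1) {ereal (real k) | k. k_connected k X}"
  assume *: "conn X = ereal (real k)"
  then have ne: "topspace X \<noteq> {}" and S: "Sup ?A = ereal (real k)"
    by (auto simp: conn_def split: if_splits)
  have "\<not> k_connected (Suc k) X"
  proof
    assume "k_connected (Suc k) X"
    then have "ereal (real (Suc k)) \<le> Sup ?A" by (intro Sup_upper) blast
    with S show False by simp
  qed
  moreover have "k_connected k X"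
  proof (rule ccontr)
    assume "\<not> k_connected k X"
    then have "Sup ?A \<le> ereal (real k - 1)"
      by (intro Sup_least) (force simp: not_le one_ereal_def dest: k_connected_mono[of _ X k])
    with S show False by simp
  qed
  ultimately show "k_connected k X \<and> \<not> k_connected (Suc k) X" by blast
next
  assume *: "k_connected k X \<and> \<not> k_connected (Suc k) X"
  then have "l \<le> k" if "k_connected l X" for l
    using that k_connected_mono[of l X "Suc k"] by (meson not_less_eq_eq)
  with * have "Sup (insert (- 1) {ereal (real k) | k. k_connected k X}) = ereal (real k)"
    by (intro Sup_eqI) (auto simp: one_ereal_def)
  with * show "conn X = ereal (real k)" by (auto simp: conn_def k_connected_def)
qed

end

(* An integral 1-cocycle c on a simplicial complex yields a map from its realization to the circle,
   sending x to exp (2 pi i sum_v x_v c(v0, v)). Around an edge loop this map winds sum c times, so a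
   loop on which c does not sum to zero is not contractible.

   Fix the colour q = n + 1. For an edge (f, w) of the exponential graph such that w takes the value
   q, recolour f by replacing q with a colour r missed by w, and let the potential of (f, w) be the
   sign of the result if it is a permutation of [n], and 0 otherwise; if w misses q, the potential is
   0. For a common neighbour w of f and g, the difference of the potentials of (f, w) and (g, w) does
   not depend on w, and is the cocycle c(f, g). (It measures the degree with which a homotopy sweeps
   the (n-2)-sphere N(K_n) over the (n-1)-sphere N(K_(n+1)).) It sums to 1 over the triangle of
   colourings (x, 1, 3, ..., n) with x = 1, 2, n + 1.

   For path-connectedness, f shares the neighbour const m (m missed by f) with every const k, k ~= m;
   as n + 1 >= 3, any two vertices have a common adjacent const k. *)
theory Submission imports Defs
begin

section \<open>Maps out of and into a realization, and paths through its simplices\<close>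

lemma continuous_map_from_geom_realization:
  assumes "\<And>S. S \<in> K \<Longrightarrow> continuous_on (closed_simplex S) f"
    and "\<And>S x. S \<in> K \<Longrightarrow> x \<in> closed_simplex S \<Longrightarrow> f x \<in> T"
  shows "continuous_map (geom_realization K) (top_of_set T) f"
proof -
  have "openin (geom_realization K) {x \<in> topspace (geom_realization K). f x \<in> U}" if "open U" for U
    unfolding openin_geom_realization
  proof (intro conjI ballI)
    fix S assume S: "S \<in> K"
    have "openin (top_of_set (closed_simplex S)) (closed_simplex S \<inter> f -` U)"
      using assms(1)[OF S] that by (rule continuous_openin_preimage_gen)
    moreover have "{x \<in> topspace (geom_realization K). f x \<in> U} \<inter> closed_simplex S
        = closed_simplex S \<inter> f -` U"
      using S by (auto simp: topspace_geom_realization)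
    ultimately show "openin (top_of_set (closed_simplex S))
        ({x \<in> topspace (geom_realization K). f x \<in> U} \<inter> closed_simplex S)"
      by simp
  qed (auto simp: topspace_geom_realization)
  then have "continuous_map (geom_realization K) euclidean f"
    by (simp add: continuous_map_def)
  then show ?thesis
    using assms(2) by (auto simp: continuous_map_in_subtopology topspace_geom_realization)
qed

text \<open>Weakly open sets have open traces on every closed simplex, so a map into one closed
  simplex needs continuity only for the topology of that simplex. Straight segments are of this
  kind.\<close>

lemma continuous_map_into_geom_realization:
  assumes "S \<in> K" "continuous_on T g" "g ` T \<subseteq> closed_simplex S"
  shows "continuous_map (top_of_set T) (geom_realization K) g"
proof -
  have "openin (top_of_set T) {x \<in> T. g x \<in> U}" if U: "openin (geom_realization K) U" for U
  proof -
    have "openin (top_of_set (closed_simplex S)) (U \<inter> closed_simplex S)"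
      using U assms(1) by (simp add: openin_geom_realization)
    moreover have "g \<in> T \<rightarrow> closed_simplex S"
      using assms(3) by blast
    ultimately have "openin (top_of_set T) (T \<inter> g -` (U \<inter> closed_simplex S))"
      by (intro continuous_openin_preimage[OF assms(2)])
    moreover have "T \<inter> g -` (U \<inter> closed_simplex S) = {x \<in> T. g x \<in> U}"
      using assms(3) by auto
    ultimately show ?thesis by simp
  qed
  moreover have "g \<in> T \<rightarrow> topspace (geom_realization K)"
    using assms(1,3) by (auto simp: topspace_geom_realization)
  ultimately show ?thesis
    by (auto simp: continuous_map_def)
qed

definition bary_segment :: "('a \<Rightarrow> real) \<Rightarrow> ('a \<Rightarrow> real) \<Rightarrow> real \<Rightarrow> 'a \<Rightarrow> real" where
  "bary_segment x y t = (\<lambda>v. (1 - t) * x v + t * y v)"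

lemma bary_segment_ends [simp]: "bary_segment x y 0 = x" "bary_segment x y 1 = y"
  by (simp_all add: bary_segment_def)

lemma bary_segment_in_closed_simplex:
  assumes "x \<in> closed_simplex S" "y \<in> closed_simplex S" "t \<in> {0..1}"
  shows "bary_segment x y t \<in> closed_simplex S"
proof -
  have "(\<Sum>v\<in>S. (1 - t) * x v + t * y v) = (1 - t) * (\<Sum>v\<in>S. x v) + t * (\<Sum>v\<in>S. y v)"
    by (simp add: sum.distrib sum_distrib_left)
  then show ?thesis
    using assms by (auto simp: closed_simplex_def bary_segment_def)
qed

lemma pathin_bary_segment:
  assumes "S \<in> K" "x \<in> closed_simplex S" "y \<in> closed_simplex S"
  shows "pathin (geom_realization K) (bary_segment x y)"
  unfolding pathin_def
proof (rule continuous_map_into_geom_realization[OF assms(1)])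
  show "continuous_on {0..1} (bary_segment x y)"
    unfolding bary_segment_def by (intro continuous_intros)
  show "bary_segment x y ` {0..1} \<subseteq> closed_simplex S"
    using bary_segment_in_closed_simplex[OF assms(2,3)] by blast
qed

lemma path_component_of_geom_realization:
  assumes "S \<in> K" "x \<in> closed_simplex S" "y \<in> closed_simplex S"
  shows "path_component_of (geom_realization K) x y"
  unfolding path_component_of_def using pathin_bary_segment[OF assms] by fastforce

abbreviation vertex_point :: "'a \<Rightarrow> 'a \<Rightarrow> real" where
  "vertex_point v \<equiv> indicator {v}"

lemma vertex_point_in_closed_simplex:
  "finite S \<Longrightarrow> v \<in> S \<Longrightarrow> vertex_point v \<in> closed_simplex S"
  by (auto simp: closed_simplex_def indicator_def if_distrib cong: if_cong)

text \<open>Four straight segments suffice, each inside one simplex: from \<open>x\<close> to a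
  vertex \<open>u\<close> of its simplex, through \<open>z\<close> to a vertex \<open>v\<close> of
  the simplex of \<open>y\<close>, and on to \<open>y\<close>.\<close>

lemma path_connected_geom_realization:
  assumes K: "\<And>S. S \<in> K \<Longrightarrow> finite S \<and> S \<noteq> {}"
    and conn: "\<And>u v. u \<in> \<Union>K \<Longrightarrow> v \<in> \<Union>K \<Longrightarrow>
      \<exists>z. (\<exists>S\<in>K. u \<in> S \<and> z \<in> S) \<and> (\<exists>T\<in>K. v \<in> T \<and> z \<in> T)"
  shows "path_connected_space (geom_realization K)"
  unfolding path_connected_space_iff_path_component
proof (intro ballI)
  let ?P = "path_component_of (geom_realization K)"
  fix x y assume "x \<in> topspace (geom_realization K)" "y \<in> topspace (geom_realization K)"
  then obtain A B where A: "A \<in> K" "x \<in> closed_simplex A" and B: "B \<in> K" "y \<in> closed_simplex B"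
    by (auto simp: topspace_geom_realization)
  obtain u v where u: "u \<in> A" and v: "v \<in> B"
    using K A(1) B(1) by blast
  then obtain z S T where S: "S \<in> K" "u \<in> S" "z \<in> S" and T: "T \<in> K" "v \<in> T" "z \<in> T"
    using conn[of u v] A(1) B(1) by blast
  note V = vertex_point_in_closed_simplex[OF conjunct1[OF K]]
  have "?P x (vertex_point u)"
    by (intro path_component_of_geom_realization[OF A] V[OF A(1) u])
  moreover have "?P (vertex_point u) (vertex_point z)"
    by (intro path_component_of_geom_realization[OF S(1)] V S)
  moreover have "?P (vertex_point z) (vertex_point v)"
    by (intro path_component_of_geom_realization[OF T(1)] V T)
  moreover have "?P (vertex_point v) y"
    by (intro path_component_of_geom_realization[OF B(1)] V[OF B(1) v] B)
  ultimately show "?P x y"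
    by (meson path_component_of_trans)
qed

section \<open>Loops in a realization, and winding numbers that detect them\<close>

lemma pathin_joinpaths:
  assumes g: "pathin X g" and h: "pathin X h" and eq: "g 1 = h 0"
  shows "pathin X (g +++ h)"
  unfolding pathin_def joinpaths_def
proof (rule continuous_map_cases_le)
  let ?I = "top_of_set {0..1::real}"
  have "continuous_map (subtopology ?I {x \<in> topspace ?I. x \<le> 1/2}) ?I (\<lambda>x. 2 * x)"
    by (auto simp: continuous_map_in_subtopology subtopology_subtopology intro!: continuous_intros)
  then show "continuous_map (subtopology ?I {x \<in> topspace ?I. x \<le> 1/2}) X (\<lambda>x. g (2 * x))"
    using continuous_map_compose[OF _ g[unfolded pathin_def]] by (simp add: o_def)
  have "continuous_map (subtopology ?I {x \<in> topspace ?I. 1/2 \<le> x}) ?I (\<lambda>x. 2 * x - 1)"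
    by (auto simp: continuous_map_in_subtopology subtopology_subtopology intro!: continuous_intros)
  then show "continuous_map (subtopology ?I {x \<in> topspace ?I. 1/2 \<le> x}) X (\<lambda>x. h (2 * x - 1))"
    using continuous_map_compose[OF _ h[unfolded pathin_def]] by (simp add: o_def)
  show "g (2 * x) = h (2 * x - 1)" if "x \<in> topspace ?I" "x = 1/2" for x
    unfolding that(2) using eq by simp
qed (auto intro!: continuous_map_from_subtopology)

text \<open>Translates from spheroids on \<open>cube 1\<close> to paths on the unit interval.
  Composing with \<open>F\<close> moves the homotopy to a subset of a type-class space, where
  covering space theory can be applied.\<close>

lemma homotopic_paths_if_trivial_homotopy_group:
  assumes triv: "is_singleton (homotopy_group 1 X x0)"
    and p: "pathin X p" "p 0 = x0" "p 1 = x0"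
    and F: "continuous_map X (top_of_set T) F"
  shows "homotopic_paths T (F \<circ> p) (\<lambda>_. F x0)"
proof -
  let ?I = "top_of_set {0..1::real}"
  let ?ev = "\<lambda>t :: nat \<Rightarrow> real. t 0"
  have ev: "continuous_map (cube 1) ?I ?ev"
    unfolding cube_def by (rule continuous_map_product_projection) simp
  have bd: "?ev t = 0 \<or> ?ev t = 1" if "t \<in> cube_boundary 1" for t
    using that by (auto simp: cube_boundary_def)
  have x0: "x0 \<in> topspace X"
    using p unfolding pathin_def continuous_map_def by auto
  have "p \<circ> ?ev \<in> spheroids 1 X x0"
    using continuous_map_compose[OF ev p(1)[unfolded pathin_def]] bd p(2,3)
    unfolding spheroids_def by force
  moreover have "(\<lambda>_. x0) \<in> spheroids 1 X x0"
    using x0 by (simp add: spheroids_def)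
  moreover obtain C where C: "spheroids 1 X x0 // spheroid_homotopy 1 X x0 = {C}"
    using triv unfolding homotopy_group_def is_singleton_def by blast
  \<comment> \<open>There is only one class, so the loop and the constant spheroid share it.\<close>
  ultimately have "spheroid_homotopy 1 X x0 `` {p \<circ> ?ev} = spheroid_homotopy 1 X x0 `` {\<lambda>_. x0}"
    by (metis C quotientI singletonD)
  then have "(p \<circ> ?ev, \<lambda>_. x0) \<in> spheroid_homotopy 1 X x0"
    using \<open>(\<lambda>_. x0) \<in> spheroids 1 X x0\<close> by (intro eq_equiv_class[OF _ equiv_spheroid_homotopy])
  then have "homotopic_with (\<lambda>h. \<forall>t\<in>cube_boundary 1. h t = x0) (cube 1) X (p \<circ> ?ev) (\<lambda>_. x0)"
    by (simp add: spheroid_homotopy_def)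
  then have hom: "homotopic_with (\<lambda>h. \<forall>t\<in>cube_boundary 1. h t = F x0) (cube 1) (top_of_set T)
      (F \<circ> (p \<circ> ?ev)) (F \<circ> (\<lambda>_. x0))"
    by (rule homotopic_with_compose_continuous_map_left[OF _ F]) simp
  \<comment> \<open>A section of \<open>?ev\<close>; points of \<open>cube 1\<close> are extensional
    functions on \<open>{..<1}\<close>, hence the \<open>restrict\<close>.\<close>
  let ?c = "\<lambda>s. restrict (\<lambda>_::nat. s::real) {..<1}"
  have c: "continuous_map ?I (cube 1) ?c"
    unfolding cube_def continuous_map_componentwise by (auto simp: continuous_map_in_subtopology)
  have cb: "?c 0 \<in> cube_boundary 1" "?c 1 \<in> cube_boundary 1"
    by (auto simp: cube_boundary_def cube_def topspace_product_topology PiE_iff)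
  have "homotopic_with (\<lambda>r. r 0 = F x0 \<and> r 1 = F x0) ?I (top_of_set T)
      (F \<circ> (p \<circ> ?ev) \<circ> ?c) (F \<circ> (\<lambda>_. x0) \<circ> ?c)"
    by (rule homotopic_with_compose_continuous_map_right[OF hom c]) (use cb in auto)
  moreover have "F \<circ> (p \<circ> ?ev) \<circ> ?c = F \<circ> p" "F \<circ> (\<lambda>_. x0) \<circ> ?c = (\<lambda>_. F x0)"
    by (auto simp: fun_eq_iff)
  ultimately show ?thesis
    using p by (simp add: homotopic_paths_def pathstart_def pathfinish_def)
qed

text \<open>Changing the base vertex from \<open>u\<close> to \<open>u'\<close> shifts the exponent
  by the integer \<open>c u' u\<close>, because barycentric coordinates sum to 1, and the
  exponential absorbs it. Hence the formulas on different simplices agree on overlaps.\<close>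

lemma exists_circle_map:
  fixes c :: "'a \<Rightarrow> 'a \<Rightarrow> int"
  assumes K: "\<And>S. S \<in> K \<Longrightarrow> finite S \<and> S \<noteq> {}"
    and c: "\<And>S u v w. S \<in> K \<Longrightarrow> u \<in> S \<Longrightarrow> v \<in> S \<Longrightarrow> w \<in> S \<Longrightarrow> c u v + c v w = c u w"
  obtains F where "continuous_map (geom_realization K) (top_of_set (- {0})) F"
    and "\<And>S x u. S \<in> K \<Longrightarrow> x \<in> closed_simplex S \<Longrightarrow> u \<in> S \<Longrightarrow>
          F x = exp (2 * of_real pi * \<i> * of_real (\<Sum>v\<in>S. x v * of_int (c u v)))"
proof
  define e :: "real \<Rightarrow> complex" where "e = (\<lambda>r. exp (2 * of_real pi * \<i> * of_real r))"
  have e_int: "e (r + of_int k) = e r" for r k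
  proof -
    have "2 * of_real pi * \<i> * complex_of_real (r + of_int k)
        = 2 * of_real pi * \<i> * of_real r + 2 * of_real pi * \<i> * of_int k"
      by (simp add: algebra_simps)
    then show ?thesis
      unfolding e_def by (simp add: exp_add exp_integer_2pi mult_ac)
  qed
  \<comment> \<open>The definition may depend on \<open>x\<close> alone, not on a simplex containing
    it: it uses the support of \<open>x\<close> and a base vertex chosen there.\<close>
  define F where "F x = e (\<Sum>v | x v \<noteq> 0. x v * of_int (c (SOME u. x u \<noteq> 0) v))" for x
  have F: "F x = e (\<Sum>v\<in>S. x v * of_int (c u v))"
    if S: "S \<in> K" and x: "x \<in> closed_simplex S" and u: "u \<in> S" for S x u
  proof -
    define u' where "u' = (SOME u. x u \<noteq> 0)"
    have fin: "finite S" using K S by blast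
    have sum1: "(\<Sum>v\<in>S. x v) = 1" and supp: "{v. x v \<noteq> 0} \<subseteq> S"
      using x by (auto simp: closed_simplex_def)
    then have "\<exists>u. x u \<noteq> 0"
      by (metis sum.neutral zero_neq_one)
    then have "x u' \<noteq> 0"
      unfolding u'_def by (rule someI_ex)
    with supp have u': "u' \<in> S" by blast
    have "(\<Sum>v | x v \<noteq> 0. x v * of_int (c u' v)) = (\<Sum>v\<in>S. x v * of_int (c u' v))"
      using fin supp by (intro sum.mono_neutral_left) auto
    also have "\<dots> = (\<Sum>v\<in>S. x v * of_int (c u v) + x v * of_int (c u' u))"
    proof (rule sum.cong)
      fix v assume "v \<in> S"
      then have "c u' v = c u' u + c u v" using c[OF S u' u] by simp
      then show "x v * of_int (c u' v) = x v * of_int (c u v) + x v * of_int (c u' u)"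
        by (simp add: algebra_simps)
    qed simp
    also have "\<dots> = (\<Sum>v\<in>S. x v * of_int (c u v)) + of_int (c u' u)"
      using sum1 by (simp add: sum.distrib flip: sum_distrib_right)
    finally show ?thesis
      unfolding F_def by (simp add: e_int flip: u'_def)
  qed
  then show "F x = exp (2 * of_real pi * \<i> * of_real (\<Sum>v\<in>S. x v * of_int (c u v)))"
    if "S \<in> K" "x \<in> closed_simplex S" "u \<in> S" for S x u
    using that unfolding e_def by blast
  show "continuous_map (geom_realization K) (top_of_set (- {0})) F"
  proof (rule continuous_map_from_geom_realization)
    fix S assume S: "S \<in> K"
    then obtain u where u: "u \<in> S" using K by blast
    have pr: "continuous_on A (\<lambda>x. x v)" for A :: "('a \<Rightarrow> real) set" and v
      by (rule continuous_on_product_then_coordinatewise) (rule continuous_on_id)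
    have "continuous_on (closed_simplex S) (\<lambda>x. e (\<Sum>v\<in>S. x v * of_int (c u v)))"
      unfolding e_def by (intro continuous_intros pr)
    then show "continuous_on (closed_simplex S) F"
      using F[OF S _ u] by (simp cong: continuous_on_cong)
  qed (simp add: F_def e_def)
qed

text \<open>The image of the edge loop in the punctured plane lifts through \<open>exp\<close> to a
  path from 0 to 2 pi i times the sum of \<open>c\<close>. If the loop were contractible, monodromy
  would give this lift the endpoint of the constant lift, which is 0.\<close>

lemma homotopy_group_1_nontrivial:
  fixes c :: "'a \<Rightarrow> 'a \<Rightarrow> int"
  assumes K: "\<And>S. S \<in> K \<Longrightarrow> finite S \<and> S \<noteq> {}"
    and c: "\<And>S u v w. S \<in> K \<Longrightarrow> u \<in> S \<Longrightarrow> v \<in> S \<Longrightarrow> w \<in> S \<Longrightarrow> c u v + c v w = c u w"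
    and edge: "{u, v} \<in> K" "{v, w} \<in> K" "{w, u} \<in> K"
    and nz: "c u v + c v w + c w u \<noteq> 0"
  shows "\<not> is_singleton (homotopy_group 1 (geom_realization K) (vertex_point u))"
proof
  assume triv: "is_singleton (homotopy_group 1 (geom_realization K) (vertex_point u))"
  obtain F where F: "continuous_map (geom_realization K) (top_of_set (- {0})) F"
    and F_eq: "\<And>S x u. S \<in> K \<Longrightarrow> x \<in> closed_simplex S \<Longrightarrow> u \<in> S \<Longrightarrow>
          F x = exp (2 * of_real pi * \<i> * of_real (\<Sum>v\<in>S. x v * of_int (c u v)))"
    by (rule exists_circle_map[of K c]) (assumption | rule K c that)+
  define seg :: "'a \<Rightarrow> 'a \<Rightarrow> real \<Rightarrow> 'a \<Rightarrow> real"
    where "seg a b = bary_segment (vertex_point a) (vertex_point b)" for a b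
  define \<tau> :: complex where "\<tau> = 2 * of_real pi * \<i>"
  have exp_tau: "exp (\<tau> * of_int k) = 1" for k
    using exp_integer_2pi[of "of_int k"] by (simp add: \<tau>_def mult_ac)
  have seg: "pathin (geom_realization K) (seg a b)" if "{a, b} \<in> K" for a b
    unfolding seg_def using that
    by (intro pathin_bary_segment[OF that] vertex_point_in_closed_simplex) auto
  have cc: "c a a = 0" if "{a, b} \<in> K" for a b
    using c[OF that, of a a a] by simp
  \<comment> \<open>Along an edge \<open>F\<close> lifts to a straight line. The integer
    \<open>k\<close> is invisible after \<open>exp\<close>, but lets the lifts of consecutive edges
    be joined end to end.\<close>
  have F_seg: "F (seg a b t) = exp (linepath (\<tau> * of_int k) (\<tau> * of_int (k + c a b)) t)"
    if ab: "{a, b} \<in> K" and t: "t \<in> {0..1}" for a b k t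
  proof -
    have "seg a b t \<in> closed_simplex {a, b}"
      unfolding seg_def using t
      by (intro bary_segment_in_closed_simplex vertex_point_in_closed_simplex) auto
    from F_eq[OF ab this, of a]
    have "F (seg a b t) = exp (\<tau> * of_real (\<Sum>v\<in>{a, b}. seg a b t v * of_int (c a v)))"
      by (simp add: \<tau>_def)
    also have "(\<Sum>v\<in>{a, b}. seg a b t v * of_int (c a v)) = t * of_int (c a b)"
      using cc[OF ab] by (cases "a = b") (auto simp: seg_def bary_segment_def)
    also have "exp (\<tau> * of_real (t * of_int (c a b)))
        = exp (\<tau> * of_int k) * exp (\<tau> * of_real (t * of_int (c a b)))"
      by (simp add: exp_tau)
    also have "\<dots> = exp (linepath (\<tau> * of_int k) (\<tau> * of_int (k + c a b)) t)"
      unfolding exp_add[symmetric]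
      by (rule arg_cong[of _ _ exp]) (simp add: linepath_def scaleR_conv_of_real algebra_simps)
    finally show ?thesis .
  qed
  define p where "p = seg u v +++ seg v w +++ seg w u"
  define l where "l = linepath (\<tau> * of_int 0) (\<tau> * of_int (0 + c u v))
    +++ linepath (\<tau> * of_int (c u v)) (\<tau> * of_int (c u v + c v w))
    +++ linepath (\<tau> * of_int (c u v + c v w)) (\<tau> * of_int (c u v + c v w + c w u))"
  have F_p: "exp (l t) = (F \<circ> p) t" if "t \<in> {0..1}" for t
    using that by (auto simp: l_def p_def joinpaths_def F_seg[OF edge(1), of _ 0, simplified]
      F_seg[OF edge(2), of _ "c u v", simplified] F_seg[OF edge(3), of _ "c u v + c v w", simplified])
  have ends: "seg a b 0 = vertex_point a" "seg a b 1 = vertex_point b" for a b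
    by (simp_all add: seg_def)
  have p: "pathin (geom_realization K) p"
    unfolding p_def using seg edge
    by (intro pathin_joinpaths) (auto simp: ends joinpaths_def)
  have p_ends: "p 0 = vertex_point u" "p 1 = vertex_point u"
    by (simp_all add: p_def joinpaths_def ends)
  have hom: "homotopic_paths (- {0}) (F \<circ> p) (\<lambda>_. F (vertex_point u))"
    using homotopic_paths_if_trivial_homotopy_group[OF triv p p_ends F] .
  have "F (vertex_point u) = exp 0"
    using F_p[of 0] p_ends by (simp add: l_def joinpaths_def linepath_def)
  moreover have "path l"
    unfolding l_def by (intro path_join_imp) auto
  moreover have "pathstart l = 0"
    by (simp add: l_def)
  \<comment> \<open>\<open>l\<close> lifts \<open>F \<circ> p\<close>, the constant 0 lifts the
    constant loop, and both start at 0.\<close>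
  ultimately have "pathfinish l = pathfinish (\<lambda>_. 0 :: complex)"
    using F_p homotopic_paths_imp_path[OF hom] homotopic_paths_imp_subset[OF hom]
    by (intro covering_space_monodromy[OF covering_space_exp_punctured_plane _ _ _ _ hom])
       (auto simp: pathstart_def path_def)
  then have "\<tau> * of_int (c u v + c v w + c w u) = 0"
    by (simp add: l_def pathfinish_def joinpaths_def linepath_def)
  with nz show False
    by (simp add: \<tau>_def del: of_int_add)
qed

section \<open>Signs of self-maps of a finite set, extended by zero to non-bijections\<close>

definition perm_sign :: "'a set \<Rightarrow> ('a \<Rightarrow> 'a) \<Rightarrow> int" where
  "perm_sign A h = (if bij_betw h A A then sign_on A h else 0)"

lemma perm_sign_eq_0: "\<not> bij_betw h A A \<Longrightarrow> perm_sign A h = 0"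
  by (simp add: perm_sign_def)

lemma perm_sign_cong: "(\<And>i. i \<in> A \<Longrightarrow> h i = h' i) \<Longrightarrow> perm_sign A h = perm_sign A h'"
  unfolding perm_sign_def using bij_betw_cong[of A h h' A] sign_on_cong[of A A h h'] by simp

lemma perm_sign_transpose:
  assumes "finite A" "bij_betw h A A" "a \<in> A" "b \<in> A" "a \<noteq> b"
  shows "perm_sign A (h \<circ> Transposition.transpose a b) = - perm_sign A h"
proof -
  have t: "bij_betw (Transposition.transpose a b) A A"
    using assms by (intro permutes_imp_bij permutes_swap_id)
  show ?thesis
    using assms sign_on_compose[OF assms(2) t assms(1)] bij_betw_trans[OF t assms(2)]
    by (simp add: perm_sign_def sign_on_transpose)
qed

text \<open>\<open>perm_sign A h\<close> is the determinant of the matrix with the unit vectors e_(h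
  b) as columns, and the rank-one matrix N with all columns e_y sends each of them to e_y. The sum
  over \<open>b\<close> of the determinants with N applied to column \<open>b\<close> is tr(N) = 1
  times the determinant. The proof below is combinatorial instead.\<close>

lemma sum_perm_sign_upd:
  assumes A: "finite A" and h: "h \<in> A \<rightarrow> A" and y: "y \<in> A"
  shows "(\<Sum>b\<in>A. perm_sign A (h(b := y))) = perm_sign A h"
proof (cases "bij_betw h A A")
  case True
  \<comment> \<open>Only the position that already carries \<open>y\<close> can be overwritten
    without repeating \<open>y\<close>.\<close>
  then obtain b0 where b0: "b0 \<in> A" "h b0 = y"
    using y by (metis bij_betw_iff_bijections)
  have "perm_sign A (h(b := y)) = 0" if "b \<in> A" "b \<noteq> b0" for b
  proof (rule perm_sign_eq_0)
    show "\<not> bij_betw (h(b := y)) A A"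
      using that b0 by (metis bij_betw_imp_inj_on fun_upd_def inj_onD)
  qed
  then have "(\<Sum>b\<in>A. perm_sign A (h(b := y))) = (\<Sum>b\<in>{b0}. perm_sign A (h(b := y)))"
    using A b0(1) by (intro sum.mono_neutral_right) auto
  also have "\<dots> = perm_sign A h"
    using b0(2) by auto
  finally show ?thesis .
next
  case False
  show ?thesis
  proof (cases "\<exists>b\<in>A. bij_betw (h(b := y)) A A")
    case True
    \<comment> \<open>Here \<open>h\<close> misses \<open>y\<close> and takes one value twice, at
      \<open>b1\<close> and \<open>b2\<close>. Overwriting either copy gives a bijection; the two
      differ by a transposition, so their signs cancel.\<close>
    then obtain b1 where b1: "b1 \<in> A" and bij: "bij_betw (h(b1 := y)) A A" ..
    have "h b1 \<noteq> y"
      using False bij by (metis fun_upd_triv)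
    moreover have "h b1 \<in> A" using h b1 by blast
    then obtain b2 where b2: "b2 \<in> A" "(h(b1 := y)) b2 = h b1"
      using bij by (metis bij_betw_iff_bijections)
    ultimately have ne: "b2 \<noteq> b1" and eq: "h b2 = h b1"
      by (auto split: if_splits)
    have "perm_sign A (h(b := y)) = 0" if "b \<in> A" "b \<notin> {b1, b2}" for b
    proof (rule perm_sign_eq_0)
      show "\<not> bij_betw (h(b := y)) A A"
      proof
        assume "bij_betw (h(b := y)) A A"
        then have "inj_on (h(b := y)) A" by (rule bij_betw_imp_inj_on)
        moreover have "(h(b := y)) b1 = (h(b := y)) b2" using that eq by auto
        ultimately have "b1 = b2" using b1 b2(1) by (rule inj_onD)
        with ne show False by simp
      qed
    qed
    then have "(\<Sum>b\<in>A. perm_sign A (h(b := y))) = (\<Sum>b\<in>{b1, b2}. perm_sign A (h(b := y)))"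
      using A b1 b2(1) by (intro sum.mono_neutral_right) auto
    also have "\<dots> = perm_sign A (h(b1 := y)) + perm_sign A (h(b2 := y))"
      using ne by simp
    finally have sum: "(\<Sum>b\<in>A. perm_sign A (h(b := y)))
        = perm_sign A (h(b1 := y)) + perm_sign A (h(b2 := y))" .
    have "h(b2 := y) = h(b1 := y) \<circ> Transposition.transpose b1 b2"
      using ne eq by (auto simp: fun_eq_iff Transposition.transpose_def)
    then have "perm_sign A (h(b2 := y)) = - perm_sign A (h(b1 := y))"
      using perm_sign_transpose[OF A bij b1 b2(1)] ne by simp
    with sum show ?thesis
      using False by (simp add: perm_sign_eq_0)
  qed (use False in \<open>simp add: perm_sign_eq_0\<close>)
qed

section \<open>The potential on edges of the exponential graph, and its cocycle\<close>

abbreviation exp_complete :: "nat \<Rightarrow> (nat \<Rightarrow> nat) graph" where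
  "exp_complete n \<equiv> exp_graph (complete_graph (n + 1)) (complete_graph n)"

lemma edges_exp_complete:
  "(f, w) \<in> edges (exp_complete n) \<longleftrightarrow>
    f \<in> {1..n} \<rightarrow>\<^sub>E {1..n+1} \<and> w \<in> {1..n} \<rightarrow>\<^sub>E {1..n+1} \<and>
    (\<forall>u\<in>{1..n}. \<forall>v\<in>{1..n}. u \<noteq> v \<longrightarrow> f u \<noteq> w v)"
  by (auto simp: exp_graph_def complete_graph_def PiE_iff)

lemma exists_missing_colour:
  fixes w :: "nat \<Rightarrow> nat"
  shows "\<exists>r. r \<in> {1..n+1} - w ` {1..n}"
proof -
  have "card (w ` {1..n}) < card {1..n+1}"
    using card_image_le[of "{1..n}" w] by simp
  then have "\<not> {1..n+1} \<subseteq> w ` {1..n}"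
    by (metis card_mono finite_atLeastAtMost finite_imageI linorder_not_less)
  then show ?thesis by blast
qed

text \<open>Any missed colour may be chosen by \<open>SOME\<close>: \<open>potential_step\<close>
  uses nothing about it except that \<open>w\<close> misses it.\<close>

definition potential :: "nat \<Rightarrow> (nat \<Rightarrow> nat) \<Rightarrow> (nat \<Rightarrow> nat) \<Rightarrow> int" where
  "potential n w f =
    (if n + 1 \<in> w ` {1..n}
     then perm_sign {1..n} ((\<lambda>x. if x = n + 1 then SOME r. r \<in> {1..n+1} - w ` {1..n} else x) \<circ> f)
     else 0)"

text \<open>The right-hand side does not mention \<open>w\<close>: a nonzero term on either side forces
  \<open>w b = n + 1\<close>, since \<open>w b\<close> avoids all the colours \<open>1, \<dots>, n\<close>, which occur elsewhere.\<close>

lemma potential_step: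
  assumes f: "(f, w) \<in> edges (exp_complete n)" and g: "(f(v := y), w) \<in> edges (exp_complete n)"
    and v: "v \<in> {1..n}"
  shows "potential n w f - potential n w (f(v := y)) = (\<Sum>b\<in>{1..n}-{v}. perm_sign {1..n} (f(b := y)))"
proof -
  have fw: "f a \<noteq> w b" if "a \<in> {1..n}" "b \<in> {1..n}" "a \<noteq> b" for a b
    using f that unfolding edges_exp_complete by blast
  have gw: "(f(v := y)) a \<noteq> w b" if "a \<in> {1..n}" "b \<in> {1..n}" "a \<noteq> b" for a b
    using g that unfolding edges_exp_complete by blast
  have yw: "y \<noteq> w b" if "b \<in> {1..n} - {v}" for b
    using gw[of v b] v that by simp
  have wr: "w b \<in> {1..n+1}" if "b \<in> {1..n}" for b
    using f that unfolding edges_exp_complete by (blast dest: PiE_mem)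
  have fr: "f a \<in> {1..n+1}" if "a \<in> {1..n}" for a
    using f that unfolding edges_exp_complete by (blast dest: PiE_mem)
  have yr: "y \<in> {1..n+1}"
    using PiE_mem[of "f(v := y)" "{1..n}" "\<lambda>_. {1..n+1}" v] g v unfolding edges_exp_complete by simp
  have w_top: "w b = n + 1"
    if b: "b \<in> {1..n} - {v}" and h: "bij_betw h {1..n} {1..n}"
      and ne: "\<And>a. a \<in> {1..n} \<Longrightarrow> h a \<noteq> w b" for b h
  proof (rule ccontr)
    assume "w b \<noteq> n + 1"
    then have "w b \<in> {1..n}" using wr[of b] b by auto
    then obtain a where "a \<in> {1..n}" "h a = w b"
      using h by (metis bij_betw_iff_bijections)
    with ne show False by blast
  qed
  have w_top_f: "w b = n + 1" if b: "b \<in> {1..n} - {v}" and nz: "perm_sign {1..n} (f(b := y)) \<noteq> 0" for b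
  proof (rule w_top[OF b])
    show "bij_betw (f(b := y)) {1..n} {1..n}"
      using nz perm_sign_eq_0 by blast
    show "(f(b := y)) a \<noteq> w b" if "a \<in> {1..n}" for a
      using that b fw[of a b] yw[of b] by auto
  qed
  show ?thesis
  proof (cases "n + 1 \<in> w ` {1..n}")
    case False
    then have "perm_sign {1..n} (f(b := y)) = 0" if "b \<in> {1..n} - {v}" for b
      using w_top_f[OF that] that by (metis DiffD1 imageI)
    then have "(\<Sum>b\<in>{1..n}-{v}. perm_sign {1..n} (f(b := y))) = 0"
      by (intro sum.neutral) blast
    then show ?thesis using False by (simp add: potential_def)
  next
    case True
    define r where "r = (SOME r. r \<in> {1..n+1} - w ` {1..n})"
    define \<rho> where "\<rho> = (\<lambda>x. if x = n + 1 then r else x)"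
    have r: "r \<in> {1..n+1} - w ` {1..n}"
      unfolding r_def using exists_missing_colour by (rule someI_ex)
    then have "r \<noteq> n + 1" using True by blast
    then have rho: "\<rho> x \<in> {1..n}" if "x \<in> {1..n+1}" for x
      using that r by (auto simp: \<rho>_def)
    have pot: "potential n w g = perm_sign {1..n} (\<rho> \<circ> g)" for g
      by (simp only: potential_def True if_True \<rho>_def r_def)
    have upd: "\<rho> \<circ> f(b := y) = (\<rho> \<circ> f)(b := \<rho> y)" for b
      by (rule fun_upd_comp)
    \<comment> \<open>If \<open>w b = n + 1\<close>, then \<open>y\<close> and the values of
      \<open>f\<close> away from \<open>b\<close> avoid \<open>n + 1\<close>, so
      \<open>\<rho>\<close> changes nothing. Otherwise both sides vanish by \<open>w_top\<close>,
      since \<open>r\<close> is not a value of \<open>w\<close>.\<close>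
    have term_eq: "perm_sign {1..n} ((\<rho> \<circ> f)(b := \<rho> y)) = perm_sign {1..n} (f(b := y))"
      if b: "b \<in> {1..n} - {v}" for b
    proof (cases "w b = n + 1")
      case True
      then show ?thesis
        using b fw[of _ b] yw[of b] by (intro perm_sign_cong) (auto simp: \<rho>_def)
    next
      case False
      have "\<not> bij_betw ((\<rho> \<circ> f)(b := \<rho> y)) {1..n} {1..n}"
      proof
        assume bij: "bij_betw ((\<rho> \<circ> f)(b := \<rho> y)) {1..n} {1..n}"
        have "((\<rho> \<circ> f)(b := \<rho> y)) a \<noteq> w b" if "a \<in> {1..n}" for a
          using that b fw[of a b] yw[of b] r by (auto simp: \<rho>_def)
        with w_top[OF b bij] False show False by blast
      qed
      moreover have "perm_sign {1..n} (f(b := y)) = 0"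
        using w_top_f[OF b] False by blast
      ultimately show ?thesis by (simp add: perm_sign_eq_0)
    qed
    \<comment> \<open>By \<open>sum_perm_sign_upd\<close> for \<open>\<rho> \<circ> f\<close>. The
      summand at \<open>b = v\<close> is the potential of \<open>f(v := y)\<close>; the others lose
      their dependence on \<open>w\<close> by \<open>term_eq\<close>.\<close>
    have "potential n w f = (\<Sum>b\<in>{1..n}. perm_sign {1..n} ((\<rho> \<circ> f)(b := \<rho> y)))"
      unfolding pot using rho fr yr by (intro sum_perm_sign_upd[symmetric]) auto
    also have "\<dots> = perm_sign {1..n} ((\<rho> \<circ> f)(v := \<rho> y))
        + (\<Sum>b\<in>{1..n}-{v}. perm_sign {1..n} ((\<rho> \<circ> f)(b := \<rho> y)))"
      using v by (intro sum.remove) auto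
    also have "\<dots> = potential n w (f(v := y)) + (\<Sum>b\<in>{1..n}-{v}. perm_sign {1..n} (f(b := y)))"
      unfolding pot upd using term_eq by simp
    finally show ?thesis by simp
  qed
qed

text \<open>Turn \<open>f\<close> into \<open>g\<close> one argument at a time. Adjacency restricts
  each value separately, so all intermediate maps stay adjacent to every common neighbour of
  \<open>f\<close> and \<open>g\<close>, and \<open>potential_step\<close> makes each increment
  independent of that neighbour.\<close>

lemma potential_diff_unique:
  assumes "(f, w) \<in> edges (exp_complete n)" "(g, w) \<in> edges (exp_complete n)"
    and "(f, w') \<in> edges (exp_complete n)" "(g, w') \<in> edges (exp_complete n)"
  shows "potential n w f - potential n w g = potential n w' f - potential n w' g"
proof -
  define h where "h = (\<lambda>k i. if i \<le> k then g i else f i)"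
  have fg: "f \<in> {1..n} \<rightarrow>\<^sub>E {1..n+1}" "g \<in> {1..n} \<rightarrow>\<^sub>E {1..n+1}"
    using assms unfolding edges_exp_complete by auto
  have h0: "h 0 = f"
    using fg by (auto simp: h_def fun_eq_iff PiE_iff extensional_def)
  have hn: "h n = g"
    using fg by (auto simp: h_def fun_eq_iff PiE_iff extensional_def)
  have hS: "h (Suc k) = (h k)(Suc k := g (Suc k))" for k
    by (auto simp: h_def fun_eq_iff le_Suc_eq)
  have adj: "(h k, u) \<in> edges (exp_complete n)"
    if "(f, u) \<in> edges (exp_complete n)" "(g, u) \<in> edges (exp_complete n)" for k u
    using that unfolding edges_exp_complete h_def PiE_iff extensional_def by auto
  have "potential n w f - potential n w (h k) = potential n w' f - potential n w' (h k)"
    if "k \<le> n" for k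
    using that
  proof (induction k)
    case 0
    then show ?case by (simp add: h0)
  next
    case (Suc k)
    have k: "Suc k \<in> {1..n}" using Suc.prems by simp
    have "potential n u (h k) - potential n u (h (Suc k))
        = (\<Sum>b\<in>{1..n}-{Suc k}. perm_sign {1..n} ((h k)(b := g (Suc k))))"
      if "(f, u) \<in> edges (exp_complete n)" "(g, u) \<in> edges (exp_complete n)" for u
      using potential_step[OF adj[OF that, of k] _ k, of "g (Suc k)"] adj[OF that, of "Suc k"]
      by (simp add: hS)
    from this[of w] this[of w'] Suc show ?case using assms by simp
  qed
  from this[of n] show ?thesis by (simp add: hn)
qed

text \<open>The cocycle. It is meaningful for pairs with a common neighbour, and only such pairs lie
  in a simplex.\<close>

definition pot_diff :: "nat \<Rightarrow> (nat \<Rightarrow> nat) \<Rightarrow> (nat \<Rightarrow> nat) \<Rightarrow> int" where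
  "pot_diff n f g =
    (let w = SOME w. (f, w) \<in> edges (exp_complete n) \<and> (g, w) \<in> edges (exp_complete n)
     in potential n w f - potential n w g)"

lemma pot_diff_eq:
  assumes "(f, w) \<in> edges (exp_complete n)" "(g, w) \<in> edges (exp_complete n)"
  shows "pot_diff n f g = potential n w f - potential n w g"
proof -
  let ?P = "\<lambda>w. (f, w) \<in> edges (exp_complete n) \<and> (g, w) \<in> edges (exp_complete n)"
  have "?P (SOME w. ?P w)"
    using assms by (intro someI[of ?P w]) blast
  then show ?thesis
    unfolding pot_diff_def Let_def using assms by (intro potential_diff_unique) auto
qed

text \<open>One \<open>w\<close> is adjacent to the whole simplex, and with it the differences
  telescope.\<close>

lemma pot_diff_cocycle:
  assumes "S \<in> neighborhood_complex (exp_complete n)" "f \<in> S" "g \<in> S" "h \<in> S"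
  shows "pot_diff n f g + pot_diff n g h = pot_diff n f h"
proof -
  obtain w where w: "\<forall>v\<in>S. (v, w) \<in> edges (exp_complete n)"
    using assms(1) unfolding neighborhood_complex_def by blast
  show ?thesis
    using w assms(2-4) by (simp add: pot_diff_eq[where w = w])
qed

section \<open>Path-connectedness of the neighborhood complex\<close>

lemma pair_in_neighborhood_complex:
  assumes "is_graph G" "(u, w) \<in> edges G" "(v, w) \<in> edges G"
  shows "{u, v} \<in> neighborhood_complex G"
  using assms unfolding neighborhood_complex_def is_graph_def by blast

lemma is_graph_exp_complete: "is_graph (exp_complete n)"
  by (intro is_graph_exp_graph is_graph_complete_graph)

lemma path_connected_neighborhood_complex:
  assumes n: "n \<ge> 2"
  shows "path_connected_space (geom_realization (neighborhood_complex (exp_complete n)))"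
proof (rule path_connected_geom_realization)
  let ?K = "neighborhood_complex (exp_complete n)"
  show "finite S \<and> S \<noteq> {}" if "S \<in> ?K" for S
    using that by (simp add: neighborhood_complex_def)
  fix f g assume "f \<in> \<Union>?K" "g \<in> \<Union>?K"
  then have fg: "f \<in> {1..n} \<rightarrow>\<^sub>E {1..n+1}" "g \<in> {1..n} \<rightarrow>\<^sub>E {1..n+1}"
    by (auto simp: neighborhood_complex_def exp_graph_def complete_graph_def)
  define const :: "nat \<Rightarrow> nat \<Rightarrow> nat" where "const = (\<lambda>m. restrict (\<lambda>_. m) {1..n})"
  have edge_const: "(h, const m) \<in> edges (exp_complete n)"
    if "h \<in> {1..n} \<rightarrow>\<^sub>E {1..n+1}" "m \<in> {1..n+1} - h ` {1..n}" for h m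
    using that unfolding edges_exp_complete const_def by auto
  have const_edge: "(const k, const m) \<in> edges (exp_complete n)"
    if "k \<in> {1..n+1}" "m \<in> {1..n+1}" "k \<noteq> m" for k m
    using that unfolding edges_exp_complete const_def by auto
  obtain m m' where m: "m \<in> {1..n+1} - f ` {1..n}" and m': "m' \<in> {1..n+1} - g ` {1..n}"
    using exists_missing_colour by blast
  \<comment> \<open>At most two colours are excluded out of at least three, as
    \<open>n \<ge> 2\<close>.\<close>
  have "card {m, m'} < card {1..n+1}"
    using n card_insert_le_m1[of 2 "{m'}" m] by simp
  then have "\<not> {1..n+1} \<subseteq> {m, m'}"
    by (metis card_mono finite.emptyI finite_insert linorder_not_less)
  then obtain k where k: "k \<in> {1..n+1}" "k \<noteq> m" "k \<noteq> m'" by blast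
  have "{f, const k} \<in> ?K"
    using pair_in_neighborhood_complex[OF is_graph_exp_complete edge_const[OF fg(1) m] const_edge] k m
    by blast
  moreover have "{g, const k} \<in> ?K"
    using pair_in_neighborhood_complex[OF is_graph_exp_complete edge_const[OF fg(2) m'] const_edge] k m'
    by blast
  ultimately show "\<exists>z. (\<exists>S\<in>?K. f \<in> S \<and> z \<in> S) \<and> (\<exists>T\<in>?K. g \<in> T \<and> z \<in> T)"
    by blast
qed

section \<open>A triangle on which the cocycle does not sum to zero\<close>

lemma exists_noncontractible_triangle:
  assumes n: "n \<ge> 2"
  obtains f g h where
    "{f, g} \<in> neighborhood_complex (exp_complete n)"
    "{g, h} \<in> neighborhood_complex (exp_complete n)"
    "{h, f} \<in> neighborhood_complex (exp_complete n)"
    "pot_diff n f g + pot_diff n g h + pot_diff n h f = 1"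
proof -
  define tri where
    "tri x = restrict (\<lambda>i. if i = 1 then x else if i = 2 then 1 else i) {1..n}" for x
  \<comment> \<open>For two of the three colours, \<open>nbr\<close> of the third is a common
    neighbour of the corresponding \<open>tri\<close>. No map is adjacent to all three
    \<open>tri\<close>, or the cocycle would sum to zero.\<close>
  define nbr where
    "nbr y = restrict (\<lambda>i. if i = 1 then 2 else if i = 2 then y else i) {1..n}" for y
  have edge: "(tri x, nbr y) \<in> edges (exp_complete n)"
    if "x \<in> {1, 2, n+1}" "y \<in> {1, 2, n+1}" "x \<noteq> y" for x y
    using that n unfolding edges_exp_complete tri_def nbr_def by auto
  have tri_upd: "tri x' = (tri x)(1 := x')" for x x'
    using n by (auto simp: tri_def fun_eq_iff)
  have diff: "pot_diff n (tri x) (tri x')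
      = (\<Sum>b\<in>{1..n}-{1}. perm_sign {1..n} ((tri x)(b := x')))"
    if "x \<in> {1, 2, n+1}" "x' \<in> {1, 2, n+1}" "y \<in> {1, 2, n+1}" "x \<noteq> y" "x' \<noteq> y" for x x' y
  proof -
    have e: "(tri x, nbr y) \<in> edges (exp_complete n)" "(tri x', nbr y) \<in> edges (exp_complete n)"
      using edge that by blast+
    have "1 \<in> {1..n}" using n by simp
    from potential_step[OF e(1) e(2)[unfolded tri_upd[of x' x]] this] show ?thesis
      unfolding pot_diff_eq[OF e] by (simp only: flip: tri_upd[of x' x])
  qed
  have simplex: "{tri x, tri x'} \<in> neighborhood_complex (exp_complete n)"
    if "x \<in> {1, 2, n+1}" "x' \<in> {1, 2, n+1}" "y \<in> {1, 2, n+1}" "x \<noteq> y" "x' \<noteq> y" for x x' y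
    using that by (intro pair_in_neighborhood_complex[OF is_graph_exp_complete, of _ "nbr y"] edge)
  have out: "perm_sign {1..n} k = 0" if "i \<in> {1..n}" "k i = n + 1" for k i
  proof (rule perm_sign_eq_0)
    show "\<not> bij_betw k {1..n} {1..n}"
      using that bij_betwE[of k "{1..n}" "{1..n}"] by force
  qed
  have "pot_diff n (tri 1) (tri 2) = (\<Sum>b\<in>{1..n}-{1}. perm_sign {1..n} ((tri 1)(b := 2)))"
    using n by (intro diff[of _ _ "n+1"]) auto
  \<comment> \<open>\<open>tri 1\<close> has colour 1 at both 1 and 2; unless position 2 is
    overwritten, the repetition remains. Overwriting it with 2 yields the identity on
    \<open>{1..n}\<close>.\<close>
  also have "\<dots> = (\<Sum>b\<in>{2}. perm_sign {1..n} ((tri 1)(b := 2)))"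
  proof (rule sum.mono_neutral_right)
    show "\<forall>b\<in>{1..n} - {1} - {2}. perm_sign {1..n} ((tri 1)(b := 2)) = 0"
    proof
      fix b assume b: "b \<in> {1..n} - {1} - {2}"
      have "((tri 1)(b := 2)) 1 = ((tri 1)(b := 2)) 2"
        using b n by (auto simp: tri_def)
      then have "\<not> inj_on ((tri 1)(b := 2)) {1..n}"
        using n by (auto dest!: inj_onD[of _ _ 1 2])
      then show "perm_sign {1..n} ((tri 1)(b := 2)) = 0"
        by (intro perm_sign_eq_0) (auto simp: bij_betw_def)
    qed
  qed (use n in auto)
  also have "\<dots> = perm_sign {1..n} ((tri 1)(2 := 2))"
    by simp
  also have "\<dots> = perm_sign {1..n} id"
    by (rule perm_sign_cong) (auto simp: tri_def)
  also have "\<dots> = 1"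
    by (simp add: perm_sign_def)
  finally have d1: "pot_diff n (tri 1) (tri 2) = 1" .
  have "pot_diff n (tri 2) (tri (n+1)) = (\<Sum>b\<in>{1..n}-{1}. perm_sign {1..n} ((tri 2)(b := n+1)))"
    using n by (intro diff[of _ _ 1]) auto
  \<comment> \<open>The colour \<open>n + 1\<close> is written in at \<open>b\<close>, so no summand
    is a permutation of \<open>{1..n}\<close>.\<close>
  also have "\<dots> = 0"
    by (intro sum.neutral ballI) (rule out, auto)
  finally have d2: "pot_diff n (tri 2) (tri (n+1)) = 0" .
  have "pot_diff n (tri (n+1)) (tri 1) = (\<Sum>b\<in>{1..n}-{1}. perm_sign {1..n} ((tri (n+1))(b := 1)))"
    using n by (intro diff[of _ _ 2]) auto
  \<comment> \<open>Position 1 carries \<open>n + 1\<close> and is never overwritten, as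
    \<open>b\<close> differs from 1.\<close>
  also have "\<dots> = 0"
    using n by (intro sum.neutral ballI out[of 1]) (auto simp: tri_def)
  finally have d3: "pot_diff n (tri (n+1)) (tri 1) = 0" .
  show ?thesis
  proof
    show "{tri 1, tri 2} \<in> neighborhood_complex (exp_complete n)"
      using n by (intro simplex[of _ _ "n+1"]) auto
    show "{tri 2, tri (n+1)} \<in> neighborhood_complex (exp_complete n)"
      using n by (intro simplex[of _ _ 1]) auto
    show "{tri (n+1), tri 1} \<in> neighborhood_complex (exp_complete n)"
      using n by (intro simplex[of _ _ 2]) auto
    show "pot_diff n (tri 1) (tri 2) + pot_diff n (tri 2) (tri (n+1))
        + pot_diff n (tri (n+1)) (tri 1) = 1"
      by (simp only: d1 d2 d3)
  qed
qed

theorem theorem1p2: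
  fixes n :: nat
  assumes "n \<ge> 2"
  shows "conn (geom_realization (neighborhood_complex
           (exp_graph (complete_graph (n + 1)) (complete_graph n)))) = 0"
proof -
  let ?K = "neighborhood_complex (exp_complete n)"
  have K: "finite S \<and> S \<noteq> {}" if "S \<in> ?K" for S
    using that by (simp add: neighborhood_complex_def)
  obtain f g h where simplices: "{f, g} \<in> ?K" "{g, h} \<in> ?K" "{h, f} \<in> ?K"
    and sum: "pot_diff n f g + pot_diff n g h + pot_diff n h f = 1"
    using exists_noncontractible_triangle[OF assms] by blast
  have "\<not> is_singleton (homotopy_group 1 (geom_realization ?K) (vertex_point f))"
    using sum by (intro homotopy_group_1_nontrivial[OF K pot_diff_cocycle simplices]) auto
  moreover have f: "vertex_point f \<in> topspace (geom_realization ?K)"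
    using simplices(1) vertex_point_in_closed_simplex[of "{f, g}" f]
    by (auto simp: topspace_geom_realization)
  \<comment> \<open>1-connectedness quantifies over all base points, so failure at
    \<open>vertex_point f\<close> is enough.\<close>
  ultimately have "\<not> k_connected (Suc 0) (geom_realization ?K)"
    by (auto simp: k_connected_def)
  moreover have "k_connected 0 (geom_realization ?K)"
    using f path_connected_neighborhood_complex[OF assms] by (auto simp: k_connected_def)
  ultimately show ?thesis
    using conn_eq_iff[of "geom_realization ?K" 0] by (simp add: zero_ereal_def)
qed

end
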